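(* Suppose that $\mathbf{x}^*$ is an optimal solution of the problem $\min\{F(\mathbf{x})\mid\mathbf{x}\in\mathcal{X}\}$, where $F(\mathbf{x})=p(x_1)+\frac12\langle\mathbf{x},\mathcal{Q}\mathbf{x}\rangle-\langle\mathbf{b},\mathbf{x}\rangle$. Let $\{\mathbf{x}^k\}$ be a sequence generated by Algorithm 1 (described in the context), and let $M=2\|\mathcal{D}^{-1/2}\|_2+\|\widehat{\mathcal{Q}}^{-1/2}\|_2$, where $\widehat{\mathcal{Q}}=\mathcal{Q}+\mathcal{T}_{\mathcal{Q}}$. (a) If $t_{k+1}=\frac{1+\sqrt{1+4t_k^2}}{2}$ for all $k\ge1$, then for all $k\ge 1$, $$0\le F(\mathbf{x}^k)-F(\mathbf{x}^* )\le\frac{2}{(k+1)^2}\Big(\|\mathbf{x}^0-\mathbf{x}^*\|_{\widehat{\mathcal{Q}}}+\bar\epsilon_k\Big)^2,\qquad \bar\epsilon_k=2M\sum_{i=1}^k\epsilon_i .$$ (b) If $t_k=1$ for all $k\ge1$, then for all $k\ge 1$, $$0\le F(\mathbf{x}^k)-F(\mathbf{x}^* )\le\frac{1}{2k}\Big(\|\mathbf{x}^0-\mathbf{x}^*\|_{\widehat{\mathcal{Q}}}+\tilde\epsilon_k\Big)^2,\qquad \tilde\epsilon_k=4M\sum_{i=1}^k i\,\epsilon_i .$$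
   Context: Let $s\ge 2$, $\mathcal{X}_i=\mathbb{R}^{n_i}$ for $i=1,\ldots,s$, and $\mathcal{X}=\mathcal{X}_1\times\cdots\times\mathcal{X}_s$; write $\mathbf{x}=(x_1;\ldots;x_s)\in\mathcal{X}$, with the standard inner product and Euclidean norm. Let $\mathcal{Q}$ be a symmetric positive semidefinite block matrix on $\mathcal{X}$ whose $(i,j)$ block for $i\le j$ is $Q_{i,j}\in\mathbb{R}^{n_i\times n_j}$ and whose $(j,i)$ block for $i<j$ is $Q_{i,j}^*$ ($^*$ denotes transpose), with every diagonal block $Q_{i,i}$ symmetric positive definite. Let $\mathcal{U}$ be the strictly block upper triangular part of $\mathcal{Q}$ and $\mathcal{D}=\mathrm{diag}(Q_{1,1},\ldots,Q_{s,s})$, so $\mathcal{Q}=\mathcal{U}+\mathcal{D}+\mathcal{U}^*$; let $\mathcal{T}_{\mathcal{Q}}=\mathcal{U}\mathcal{D}^{-1}\mathcal{U}^*$. The matrix $\widehat{\mathcal{Q}}=\mathcal{Q}+\mathcal{T}_{\mathcal{Q}}=(\mathcal{D}+\mathcal{U})\mathcal{D}^{-1}(\mathcal{D}+\mathcal{U}^* )$ is positive definite. Let $\mathbf{b}\in\mathcal{X}$, $q(\mathbf{x})=\frac12\langle\mathbf{x},\mathcal{Q}\mathbf{x}\rangle-\langle\mathbf{b},\mathbf{x}\rangle$, and let $p:\mathcal{X}_1\to(-\infty,\infty]$ be a proper closed convex function. For a symmetric positive semidefinite $\mathcal{T}$, $\|\mathbf{x}\|_{\mathcal{T}}^2=\langle\mathbf{x},\mathcal{T}\mathbf{x}\rangle$;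 $\|\cdot\|_2$ is the spectral norm. For $\boldsymbol{\delta}',\boldsymbol{\delta}\in\mathcal{X}$, $\Delta(\boldsymbol{\delta}',\boldsymbol{\delta})=\boldsymbol{\delta}+\mathcal{U}\mathcal{D}^{-1}(\boldsymbol{\delta}-\boldsymbol{\delta}')$. Algorithm 1. Input: $\widetilde{\mathbf{x}}^1=\mathbf{x}^0\in\mathrm{dom}(p)\times\mathbb{R}^{n_2}\times\cdots\times\mathbb{R}^{n_s}$, $t_1=1$, and a summable sequence of nonnegative numbers $\{\epsilon_k\}_{k\ge 1}$. For $k=1,2,\ldots$: Step 1. Compute $$\mathbf{x}^k=\operatorname*{argmin}_{\mathbf{x}\in\mathcal{X}}\Big\{p(x_1)+q(\mathbf{x})+\tfrac12\|\mathbf{x}-\widetilde{\mathbf{x}}^k\|_{\mathcal{T}_{\mathcal{Q}}}^2-\langle\mathbf{x},\Delta(\widetilde{\boldsymbol{\delta}}^k,\boldsymbol{\delta}^k)\rangle\Big\},$$ where $\widetilde{\boldsymbol{\delta}}^k,\boldsymbol{\delta}^k\in\mathcal{X}$ are error vectors with equal first blocks, $\widetilde\delta^k_1=\delta^k_1$, such that $\max\{\|\widetilde{\boldsymbol{\delta}}^k\|,\|\boldsymbol{\delta}^k\|\}\le\epsilon_k/t_k$. (The minimizer is unique, and is computed by one inexact block symmetric Gauss-Seidel cycle with these error vectors.) Step 2. Choose $t_{k+1}$ such that $t_{k+1}^2-t_{k+1}\le t_k^2$, set $\beta_k=\frac{t_k-1}{t_{k+1}}$ and $\widetilde{\mathbf{x}}^{k+1}=\mathbf{x}^k+\beta_k(\mathbf{x}^k-\mathbf{x}^{k-1})$.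 *)

theory Defs
  imports "HOL-Analysis.Analysis"
begin

(* The space X = X_1 x ... x X_s with X_i = R^(n_i) is real^'n, where a map blk :: 'n => nat with
   range {1..s} assigns to every coordinate the number of its block; n_i is the number of
   coordinates in block i. The first factor X_1 also occurs as a space of its own, real^'m, and
   e :: 'm => 'n enumerates the coordinates of block 1. *)

definition first_block :: "('m \<Rightarrow> 'n) \<Rightarrow> real^'n \<Rightarrow> real^'m" where
  "first_block e x = (\<chi> j. x $ e j)"

definition psd :: "real^'n^'n \<Rightarrow> bool" where
  "psd A \<longleftrightarrow> transpose A = A \<and> (\<forall>x. 0 \<le> x \<bullet> (A *v x))"

(* Positive definiteness of the (i,i) block: X_i is identified with the vectors of X vanishing
   outside block i, on which the quadratic forms of A and of its (i,i) block coincide. Symmetry of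
   the block is inherited from A. *)
definition diag_block_pd :: "('n \<Rightarrow> nat) \<Rightarrow> real^'n^'n \<Rightarrow> nat \<Rightarrow> bool" where
  "diag_block_pd blk A i \<longleftrightarrow>
     (\<forall>x. x \<noteq> 0 \<and> (\<forall>k. blk k \<noteq> i \<longrightarrow> x $ k = 0) \<longrightarrow> 0 < x \<bullet> (A *v x))"

definition upper_part :: "('n \<Rightarrow> nat) \<Rightarrow> real^'n^'n \<Rightarrow> real^'n^'n" where
  "upper_part blk Q = (\<chi> k l. if blk k < blk l then Q $ k $ l else 0)"

definition diag_part :: "('n \<Rightarrow> nat) \<Rightarrow> real^'n^'n \<Rightarrow> real^'n^'n" where
  "diag_part blk Q = (\<chi> k l. if blk k = blk l then Q $ k $ l else 0)"

definition sGS_op :: "('n \<Rightarrow> nat) \<Rightarrow> real^'n^'n \<Rightarrow> real^'n^'n" where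
  "sGS_op blk Q =
     upper_part blk Q ** matrix_inv (diag_part blk Q) ** transpose (upper_part blk Q)"

definition Q_hat :: "('n \<Rightarrow> nat) \<Rightarrow> real^'n^'n \<Rightarrow> real^'n^'n" where
  "Q_hat blk Q = Q + sGS_op blk Q"

definition wnorm :: "real^'n^'n \<Rightarrow> real^'n \<Rightarrow> real" where
  "wnorm T x = sqrt (x \<bullet> (T *v x))"

definition spectral_norm :: "real^'n^'m \<Rightarrow> real" where
  "spectral_norm A = onorm (\<lambda>x. A *v x)"

definition psd_sqrt :: "real^'n^'n \<Rightarrow> real^'n^'n" where
  "psd_sqrt A = (THE B. psd B \<and> B ** B = A)"

definition inv_sqrt :: "real^'n^'n \<Rightarrow> real^'n^'n" where
  "inv_sqrt A = matrix_inv (psd_sqrt A)"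

definition M_const :: "('n \<Rightarrow> nat) \<Rightarrow> real^'n^'n \<Rightarrow> real" where
  "M_const blk Q =
     2 * spectral_norm (inv_sqrt (diag_part blk Q)) + spectral_norm (inv_sqrt (Q_hat blk Q))"

definition quad :: "real^'n^'n \<Rightarrow> real^'n \<Rightarrow> real^'n \<Rightarrow> real" where
  "quad Q b x = 1/2 * (x \<bullet> (Q *v x)) - b \<bullet> x"

definition objective ::
  "('m \<Rightarrow> 'n) \<Rightarrow> (real^'m \<Rightarrow> ereal) \<Rightarrow> real^'n^'n \<Rightarrow> real^'n \<Rightarrow> real^'n \<Rightarrow> ereal" where
  "objective e p Q b x = p (first_block e x) + ereal (quad Q b x)"

(* The library's epigraph is for real-valued functions only. *)
definition ereal_epigraph :: "('a \<Rightarrow> ereal) \<Rightarrow> ('a \<times> real) set" where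
  "ereal_epigraph f = {(x, r). f x \<le> ereal r}"

definition proper_closed_convex :: "('a::real_normed_vector \<Rightarrow> ereal) \<Rightarrow> bool" where
  "proper_closed_convex f \<longleftrightarrow>
     (\<forall>x. f x \<noteq> -\<infinity>) \<and> (\<exists>x. f x \<noteq> \<infinity>) \<and>
     closed (ereal_epigraph f) \<and> convex (ereal_epigraph f)"

definition Delta :: "('n \<Rightarrow> nat) \<Rightarrow> real^'n^'n \<Rightarrow> real^'n \<Rightarrow> real^'n \<Rightarrow> real^'n" where
  "Delta blk Q d' d = d + (upper_part blk Q ** matrix_inv (diag_part blk Q)) *v (d - d')"

(* xt, dt, d stand for the sequences x-tilde, delta-tilde and delta. All sequences are indexed from
   1, except x, which is indexed from 0. *)
definition algorithm1 ::
  "('n \<Rightarrow> nat) \<Rightarrow> ('m \<Rightarrow> 'n) \<Rightarrow> (real^'m \<Rightarrow> ereal) \<Rightarrow> real^'n^'n \<Rightarrow> real^'n \<Rightarrow>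
   (nat \<Rightarrow> real^'n) \<Rightarrow> (nat \<Rightarrow> real^'n) \<Rightarrow> (nat \<Rightarrow> real^'n) \<Rightarrow> (nat \<Rightarrow> real^'n) \<Rightarrow>
   (nat \<Rightarrow> real) \<Rightarrow> (nat \<Rightarrow> real) \<Rightarrow> bool" where
  "algorithm1 blk e p Q b x xt dt d t \<epsilon> \<longleftrightarrow>
     p (first_block e (x 0)) < \<infinity> \<and> xt 1 = x 0 \<and> t 1 = 1 \<and>
     (\<forall>k\<ge>1. 0 \<le> \<epsilon> k) \<and> summable (\<lambda>k. \<epsilon> (Suc k)) \<and>
     (\<forall>k\<ge>1.
        first_block e (dt k) = first_block e (d k) \<and>
        max (norm (dt k)) (norm (d k)) \<le> \<epsilon> k / t k \<and>
        is_arg_min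
          (\<lambda>z. p (first_block e z) +
             ereal (quad Q b z + 1/2 * (wnorm (sGS_op blk Q) (z - xt k))\<^sup>2
                    - z \<bullet> Delta blk Q (dt k) (d k)))
          (\<lambda>z. True) (x k) \<and>
        (t (k + 1))\<^sup>2 - t (k + 1) \<le> (t k)\<^sup>2 \<and>
        xt (k + 1) = x k + ((t k - 1) / t (k + 1)) *\<^sub>R (x k - x (k - 1)))"

end

theory Submission
  imports Defs
begin

text \<open>Write \<open>H = Q_hat blk Q\<close>. The objective of Step 1 is a convex function plus \<open>\<parallel>\<cdot>\<parallel>\<^sub>H\<^sup>2 / 2\<close>, so its
  minimizer satisfies the three-point inequality of a proximal gradient step in the norm of \<open>H\<close>, up to
  the error term \<open>\<langle>z - x\<^sub>k, \<Delta>\<rangle>\<close>, which is at most \<open>M \<epsilon>\<^sub>k / t\<^sub>k \<cdot> \<parallel>z - x\<^sub>k\<parallel>\<^sub>H\<close>. As in the analysis of FISTA,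
  applying the inequality to a convex combination of \<open>x\<^sup>*\<close> and \<open>x\<^bsub>k-1\<^esub>\<close> (for constant \<open>t\<close>, to both
  separately) gives a potential \<open>W\<^sub>k\<close> with \<open>W\<^sub>k \<le> W\<^bsub>k-1\<^esub> + O(\<epsilon>\<^sub>k \<surd>W\<^sub>k)\<close>. Hence \<open>\<surd>W\<^sub>k\<close> grows at
  most additively with the errors.\<close>

section \<open>Square roots of positive semidefinite matrices\<close>

text \<open>A maximizer \<open>v\<close> of the Rayleigh quotient on the compact unit sphere of
  \<open>S\<close> is an eigenvector: the residual \<open>w\<close> lies in \<open>S\<close> by
  invariance, and moving \<open>v\<close> along \<open>-w\<close> would raise the quotient unless
  \<open>w = 0\<close>.\<close>

lemma selfadjoint_eigenvector:
  fixes f :: "'a::euclidean_space \<Rightarrow> 'a"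
  assumes "linear f" and adj: "\<And>x y. f x \<bullet> y = x \<bullet> f y"
    and "subspace S" and inv: "\<And>x. x \<in> S \<Longrightarrow> f x \<in> S" and "u \<in> S" "u \<noteq> 0"
  obtains v c where "v \<in> S" "norm v = 1" "f v = c *\<^sub>R v"
proof -
  interpret linear f by fact
  let ?K = "S \<inter> sphere 0 1"
  have "compact ?K"
    using closed_subspace[OF \<open>subspace S\<close>] by (simp add: closed_Int_compact)
  moreover have "(1 / norm u) *\<^sub>R u \<in> ?K"
    using \<open>u \<in> S\<close> \<open>u \<noteq> 0\<close> \<open>subspace S\<close> by (simp add: subspace_scale)
  then have "?K \<noteq> {}" by blast
  moreover have "continuous_on ?K (\<lambda>x. x \<bullet> f x)"
    using linear_continuous_on[of f] linear_axioms
    by (intro continuous_intros) (auto simp: linear_conv_bounded_linear)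
  ultimately obtain v where v: "v \<in> ?K" and max: "\<And>y. y \<in> ?K \<Longrightarrow> y \<bullet> f y \<le> v \<bullet> f v"
    using continuous_attains_sup by metis
  define c where "c = v \<bullet> f v"
  have le: "y \<bullet> f y \<le> c * (y \<bullet> y)" if "y \<in> S" for y
  proof (cases "y = 0")
    case False
    have "(1 / norm y) *\<^sub>R y \<in> ?K"
      using that False \<open>subspace S\<close> by (simp add: subspace_scale)
    then have "((1 / norm y) *\<^sub>R y) \<bullet> f ((1 / norm y) *\<^sub>R y) \<le> c"
      unfolding c_def by (rule max)
    then show ?thesis
      using False by (simp add: scale field_simps dot_square_norm power2_eq_square)
  qed (simp add: zero)
  define w where "w = c *\<^sub>R v - f v"
  have vv: "v \<bullet> v = 1" and vS: "v \<in> S" using v by (auto simp: dot_square_norm)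
  have wS: "w \<in> S" unfolding w_def using vS inv \<open>subspace S\<close>
    by (simp add: subspace_scale subspace_diff)
  define k where "k = c * (w \<bullet> w) - w \<bullet> f w"
  \<comment> \<open>This is \<open>le\<close> at \<open>v - r *\<^sub>R w\<close>. The terms of
    order zero cancel because \<open>v\<close> attains the maximum \<open>c\<close>; dividing by
    \<open>r\<close> leaves the first-order term \<open>2 * (w \<bullet> w)\<close>, which a small
    \<open>r\<close> then forces to vanish.\<close>
  have quad_le: "2 * (w \<bullet> w) \<le> r * k" if "0 < r" for r
  proof -
    have "v - r *\<^sub>R w \<in> S"
      using vS wS \<open>subspace S\<close> by (simp add: subspace_scale subspace_diff)
    from le[OF this] have "r * (2 * (c * (v \<bullet> w) - w \<bullet> f v)) \<le> r * (r * k)"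
      using adj[of v w] by (simp add: k_def diff scale inner_simps inner_commute vv c_def algebra_simps)
    moreover have "c * (v \<bullet> w) - w \<bullet> f v = w \<bullet> w"
      by (simp add: w_def inner_simps inner_commute algebra_simps)
    ultimately show ?thesis using that by simp
  qed
  have "w \<bullet> w = 0"
  proof (rule ccontr)
    assume "w \<bullet> w \<noteq> 0"
    then have "w \<bullet> w > 0" by simp
    then have "k > 0" using quad_le[of 1] by linarith
    with quad_le[of "(w \<bullet> w) / k"] \<open>w \<bullet> w > 0\<close> show False by simp
  qed
  then have "f v = c *\<^sub>R v" by (simp add: w_def)
  then show ?thesis using that vS v by auto
qed

text \<open>An orthonormal family of eigenvectors of greatest cardinality must span: its orthogonal
  complement is invariant under \<open>f\<close>, so a nonzero complement would contain one more
  unit eigenvector.\<close>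

lemma selfadjoint_orthonormal_eigenbasis:
  fixes f :: "'a::euclidean_space \<Rightarrow> 'a"
  assumes "linear f" and adj: "\<And>x y. f x \<bullet> y = x \<bullet> f y"
  obtains B c where "finite B" "pairwise orthogonal B" "\<And>v. v \<in> B \<Longrightarrow> norm v = 1" "span B = UNIV"
    "\<And>v. v \<in> B \<Longrightarrow> f v = c v *\<^sub>R v"
proof -
  let ?P = "\<lambda>B. pairwise orthogonal B \<and> (\<forall>v\<in>B. norm v = 1 \<and> (\<exists>c. f v = c *\<^sub>R v))"
  have card: "card B < Suc DIM('a)" and fin: "finite B" if "?P B" for B
  proof -
    have "independent B"
      using that by (intro pairwise_orthogonal_independent) auto
    then show "finite B" "card B < Suc DIM('a)" using independent_bound[of B] by auto
  qed
  have "?P {}" by (simp add: pairwise_def)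
  then obtain B where B: "?P B" and max: "\<And>C. ?P C \<Longrightarrow> card C \<le> card B"
  proof -
    have "\<exists>B. ?P B \<and> (\<forall>C. ?P C \<longrightarrow> card C \<le> card B)"
      using \<open>?P {}\<close> card by (intro ex_has_greatest_nat[where k = "{}" and b = "Suc DIM('a)"]) simp_all
    then show ?thesis using that by blast
  qed
  have "span B = UNIV"
  proof (rule ccontr)
    assume "span B \<noteq> UNIV"
    then obtain u where u: "u \<noteq> 0" "\<And>y. y \<in> span B \<Longrightarrow> orthogonal u y"
      using orthogonal_to_subspace_exists_gen[of B UNIV] by auto
    let ?S = "{x. \<forall>b\<in>B. b \<bullet> x = 0}"
    have "subspace ?S"
      using subspace_orthogonal_to_vectors[of B] by (simp add: orthogonal_def)
    moreover have "f x \<in> ?S" if "x \<in> ?S" for x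
    proof -
      have "b \<bullet> f x = 0" if b: "b \<in> B" for b
      proof -
        obtain c where "f b = c *\<^sub>R b" using B b by blast
        then have "b \<bullet> f x = c * (b \<bullet> x)" using adj[of b x] by simp
        then show ?thesis using \<open>x \<in> ?S\<close> b by simp
      qed
      then show ?thesis by simp
    qed
    moreover have "u \<in> ?S"
      using u(2)[OF span_base] by (simp add: orthogonal_def inner_commute)
    ultimately obtain v c where v: "v \<in> ?S" "norm v = 1" "f v = c *\<^sub>R v"
      by (rule selfadjoint_eigenvector[OF assms _ _ _ \<open>u \<noteq> 0\<close>])
    have "v \<notin> B" using v by auto
    have "pairwise orthogonal (insert v B)"
      using B v(1) by (intro pairwise_orthogonal_insert) (auto simp: orthogonal_def inner_commute)
    then have "?P (insert v B)" using B v(2,3) by blast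
    from max[OF this] show False using \<open>v \<notin> B\<close> fin[OF B] by simp
  qed
  moreover from B obtain c where "\<And>v. v \<in> B \<Longrightarrow> f v = c v *\<^sub>R v" by metis
  ultimately show ?thesis using that B fin[OF B] by blast
qed

lemma inner_symmetric_matrix:
  fixes A :: "real^'n^'n"
  assumes "transpose A = A"
  shows "(A *v x) \<bullet> y = x \<bullet> (A *v y)"
  by (metis assms dot_lmul_matrix transpose_matrix_vector)

lemma transpose_eqI_inner:
  fixes A :: "real^'n^'n"
  assumes "\<And>x y. (A *v x) \<bullet> y = x \<bullet> (A *v y)"
  shows "transpose A = A"
proof -
  have "transpose A *v x = A *v x" for x
  proof (rule vector_eq_rdot[THEN iffD1], rule allI)
    fix y
    show "(transpose A *v x) \<bullet> y = (A *v x) \<bullet> y"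
      by (simp add: assms dot_lmul_matrix del: vector_transpose_matrix)
  qed
  then show ?thesis by (simp add: matrix_eq)
qed

text \<open>The root scales each vector \<open>v\<close> of an orthonormal eigenbasis by the square
  root of its eigenvalue; \<open>g\<close> writes this map as a sum of rank-one projections.\<close>

lemma psd_sqrt_exists:
  fixes A :: "real^'n^'n"
  assumes "psd A"
  shows "\<exists>B. psd B \<and> B ** B = A"
proof -
  have adj: "(A *v x) \<bullet> y = x \<bullet> (A *v y)" for x y
    using assms by (simp add: psd_def inner_symmetric_matrix)
  have pos: "0 \<le> x \<bullet> (A *v x)" for x using assms by (simp add: psd_def)
  obtain E c where E: "finite E" "pairwise orthogonal E" "\<And>v. v \<in> E \<Longrightarrow> norm v = 1" "span E = UNIV"
    "\<And>v. v \<in> E \<Longrightarrow> A *v v = c v *\<^sub>R v"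
    using selfadjoint_orthonormal_eigenbasis[OF matrix_vector_mul_linear adj] by metis
  have c: "0 \<le> c v" if "v \<in> E" for v
    using pos[of v] E(3,5)[OF that] by (simp add: dot_square_norm)
  define r where "r v = sqrt (c v)" for v
  define g where "g x = (\<Sum>v\<in>E. (r v * (v \<bullet> x)) *\<^sub>R v)" for x
  have lin: "linear g"
    by (rule linearI) (simp_all add: g_def inner_simps algebra_simps sum.distrib scaleR_sum_right)
  define B where "B = matrix g"
  have B: "B *v x = g x" for x unfolding B_def by (simp add: matrix_works lin)
  have gv: "g v = r v *\<^sub>R v" if "v \<in> E" for v
  proof -
    have "g v = (\<Sum>w\<in>E. if w = v then r v *\<^sub>R v else 0)"
      unfolding g_def using E(2,3) that
      by (intro sum.cong) (auto simp: pairwise_def orthogonal_def dot_square_norm)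
    then show ?thesis using E(1) that by simp
  qed
  have "transpose B = B"
    by (rule transpose_eqI_inner)
      (simp add: B g_def inner_sum_left inner_sum_right inner_commute algebra_simps)
  moreover have "0 \<le> x \<bullet> (B *v x)" for x
  proof -
    have "x \<bullet> (B *v x) = (\<Sum>v\<in>E. r v * (v \<bullet> x)\<^sup>2)"
      by (simp add: B g_def inner_sum_right inner_commute power2_eq_square algebra_simps)
    also have "\<dots> \<ge> 0" by (intro sum_nonneg) (simp add: r_def c)
    finally show ?thesis .
  qed
  moreover have "B ** B = A"
  proof -
    have "g (g v) = A *v v" if "v \<in> E" for v
    proof -
      have "g (g v) = (r v * r v) *\<^sub>R v"
        using gv[OF that] linear_scale[OF lin] by simp
      also have "r v * r v = c v" by (simp add: r_def c that)
      finally show ?thesis using E(5)[OF that] by simp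
    qed
    then have "g (g x) = A *v x" for x
      using linear_eq_on[of "g \<circ> g" "(*v) A" x E] lin E(4)
      by (simp add: linear_compose)
    then show ?thesis by (simp add: matrix_eq B flip: matrix_vector_mul_assoc)
  qed
  ultimately show ?thesis unfolding psd_def by blast
qed

text \<open>With a root \<open>B\<close> the quadratic form is the squared norm of
  \<open>B *v x\<close>, so it vanishes only if \<open>B *v x\<close> does, and then so does
  \<open>B *v (B *v x)\<close>.\<close>

lemma psd_mult_eq_0:
  assumes "psd A" "x \<bullet> (A *v x) = 0"
  shows "A *v x = 0"
proof -
  obtain B where B: "psd B" "B ** B = A" using psd_sqrt_exists[OF assms(1)] by blast
  have "(B *v x) \<bullet> (B *v x) = x \<bullet> (A *v x)"
    using B by (simp add: psd_def inner_symmetric_matrix matrix_vector_mul_assoc)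
  then have "B *v x = 0" using assms(2) by simp
  then show ?thesis using B(2) by (metis matrix_vector_mul_assoc matrix_vector_mult_0_right)
qed

text \<open>An eigenbasis of the difference \<open>D\<close> suffices, without knowing that
  \<open>B\<close> and \<open>C\<close> commute. For an eigenvector with nonzero eigenvalue the
  forms of \<open>B\<close> and \<open>C\<close> add up to zero, hence both matrices annihilate it,
  a contradiction.\<close>

lemma psd_sqrt_unique:
  fixes B C :: "real^'n^'n"
  assumes B: "psd B" and C: "psd C" and eq: "B ** B = C ** C"
  shows "B = C"
proof -
  define D where "D = B - C"
  have D: "D *v x = B *v x - C *v x" for x by (simp add: D_def matrix_vector_mult_diff_rdistrib)
  have adj: "(D *v x) \<bullet> y = x \<bullet> (D *v y)" for x y
    using B C by (simp add: D psd_def inner_symmetric_matrix inner_simps)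
  \<comment> \<open>The mixed products cancel in B(B - C) + (B - C)C, leaving the difference of the
    two squares.\<close>
  have anti: "B *v (D *v x) + D *v (C *v x) = 0" for x
    using arg_cong[OF eq, of "\<lambda>M. M *v x"]
    by (simp add: D matrix_vector_mult_diff_distrib flip: matrix_vector_mul_assoc)
  obtain E c where E: "span E = UNIV" "\<And>v. v \<in> E \<Longrightarrow> D *v v = c v *\<^sub>R v"
    using selfadjoint_orthonormal_eigenbasis[OF matrix_vector_mul_linear adj] by metis
  have "D *v v = 0" if "v \<in> E" for v
  proof (cases "c v = 0")
    case True
    then show ?thesis using E(2)[OF that] by simp
  next
    case False
    have "0 = v \<bullet> (B *v (D *v v)) + v \<bullet> (D *v (C *v v))"
      using anti[of v] by (simp flip: inner_add_right)
    also have "\<dots> = c v * (v \<bullet> (B *v v)) + c v * (v \<bullet> (C *v v))"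
      by (simp add: E(2)[OF that] matrix_vector_mult_scaleR flip: adj)
    finally have "v \<bullet> (B *v v) + v \<bullet> (C *v v) = 0"
      using False by (simp flip: distrib_left)
    moreover have "0 \<le> v \<bullet> (B *v v)" "0 \<le> v \<bullet> (C *v v)" using B C by (auto simp: psd_def)
    ultimately have "v \<bullet> (B *v v) = 0" "v \<bullet> (C *v v) = 0" by linarith+
    then have "B *v v = 0" "C *v v = 0" using psd_mult_eq_0 B C by blast+
    then show ?thesis by (simp add: D)
  qed
  then have "D *v x = 0" for x
    using linear_eq_0_on_span[of "(*v) D" E x] E(1) by simp
  then show ?thesis by (simp add: D matrix_eq)
qed

text \<open>Existence and uniqueness together make the definite description in
  \<open>psd_sqrt\<close> denote the root.\<close>

lemma psd_sqrt:
  assumes "psd A"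
  shows "psd (psd_sqrt A)" "psd_sqrt A ** psd_sqrt A = A"
proof -
  have "\<exists>!B. psd B \<and> B ** B = A"
    using psd_sqrt_exists[OF assms] psd_sqrt_unique by blast
  from theI'[OF this] show "psd (psd_sqrt A)" "psd_sqrt A ** psd_sqrt A = A"
    by (simp_all add: psd_sqrt_def)
qed

section \<open>Inverses of positive definite matrices and the dual norm inequality\<close>

lemma matrix_inv_inverse:
  fixes A :: "real^'n^'n"
  assumes "\<And>x. A *v x = 0 \<Longrightarrow> x = 0"
  shows "A ** matrix_inv A = mat 1" "matrix_inv A ** A = mat 1"
proof -
  have "\<exists>B. B ** A = mat 1" using assms matrix_left_invertible_ker by blast
  then have "\<exists>B. A ** B = mat 1 \<and> B ** A = mat 1" by (metis matrix_left_right_inverse)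
  from someI_ex[OF this] show "A ** matrix_inv A = mat 1" "matrix_inv A ** A = mat 1"
    by (simp_all add: matrix_inv_def)
qed

lemma symmetric_matrix_inv:
  fixes A :: "real^'n^'n"
  assumes "\<And>x. A *v x = 0 \<Longrightarrow> x = 0" "transpose A = A"
  shows "transpose (matrix_inv A) = matrix_inv A"
proof -
  note inv = matrix_inv_inverse[OF assms(1)]
  have "transpose (matrix_inv A) ** A = mat 1"
    using inv(1) by (metis assms(2) matrix_transpose_mul transpose_mat)
  then have "transpose (matrix_inv A) ** A ** matrix_inv A = matrix_inv A" by simp
  then show ?thesis using inv(1) by (simp flip: matrix_mul_assoc)
qed

text \<open>Everything rests on the root \<open>R\<close> being invertible. The last claim is
  Cauchy-Schwarz after inserting \<open>R\<close> and its inverse into the inner product; it bounds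
  a pairing by the norm of \<open>A\<close> times the dual norm. The lemma serves both the block
  diagonal part and \<open>Q_hat\<close>.\<close>

lemma inv_sqrt_pd:
  fixes A :: "real^'n^'n"
  assumes sym: "transpose A = A" and pd: "\<And>x. x \<noteq> 0 \<Longrightarrow> 0 < x \<bullet> (A *v x)"
  shows "transpose (inv_sqrt A) = inv_sqrt A" "inv_sqrt A ** inv_sqrt A = matrix_inv A"
    and "A ** matrix_inv A = mat 1" "matrix_inv A ** A = mat 1"
    and "\<bar>x \<bullet> y\<bar> \<le> wnorm A x * norm (inv_sqrt A *v y)"
proof -
  have "0 \<le> x \<bullet> (A *v x)" for x using pd[of x] by (cases "x = 0") auto
  with sym have "psd A" by (simp add: psd_def)
  define R where "R = psd_sqrt A"
  have R: "psd R" "R ** R = A" using psd_sqrt[OF \<open>psd A\<close>] by (simp_all add: R_def)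
  have ker_A: "x = 0" if "A *v x = 0" for x using pd[of x] that by fastforce
  have ker_R: "x = 0" if "R *v x = 0" for x
    using that R(2) ker_A by (metis matrix_vector_mul_assoc matrix_vector_mult_0_right)
  show 1: "A ** matrix_inv A = mat 1" "matrix_inv A ** A = mat 1"
    using matrix_inv_inverse ker_A by blast+
  have 2: "R ** inv_sqrt A = mat 1" "inv_sqrt A ** R = mat 1"
    using matrix_inv_inverse[of R] ker_R by (simp_all add: inv_sqrt_def R_def)
  show 3: "transpose (inv_sqrt A) = inv_sqrt A"
    using symmetric_matrix_inv[of R] ker_R R(1) by (simp add: inv_sqrt_def R_def psd_def)
  have "inv_sqrt A ** inv_sqrt A ** A = inv_sqrt A ** (inv_sqrt A ** R) ** R"
    using R(2) by (simp add: matrix_mul_assoc flip: matrix_mul_assoc[of _ R R])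
  also have "\<dots> = mat 1" by (simp add: 2)
  finally have "inv_sqrt A ** inv_sqrt A ** (A ** matrix_inv A) = matrix_inv A"
    by (simp add: matrix_mul_assoc)
  then show "inv_sqrt A ** inv_sqrt A = matrix_inv A" by (simp add: 1)
  have "(R *v x) \<bullet> (R *v x) = x \<bullet> (A *v x)"
    using R by (simp add: psd_def inner_symmetric_matrix matrix_vector_mul_assoc)
  then have "norm (R *v x) = wnorm A x" by (simp add: wnorm_def norm_eq_sqrt_inner)
  moreover have "x \<bullet> y = (R *v x) \<bullet> (inv_sqrt A *v y)"
    using R(1) 2(1) by (simp add: psd_def inner_symmetric_matrix matrix_vector_mul_assoc)
  ultimately show "\<bar>x \<bullet> y\<bar> \<le> wnorm A x * norm (inv_sqrt A *v y)"
    using Cauchy_Schwarz_ineq2[of "R *v x" "inv_sqrt A *v y"] by simp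
qed

section \<open>Inexact accelerated proximal gradient iterations\<close>

text \<open>One step of the error accumulation. The hypotheses give (a - r - 2c)(a + r) \<le> 0,
  hence a \<le> r + 2c, and with this bound on \<open>a\<close> the right-hand side completes to the
  square of r + 2c. Here \<open>w\<close> is the new potential, \<open>a\<close> its norm part and
  \<open>r\<close> a bound on the root of the old potential.\<close>

lemma perturbed_square_recursion:
  fixes a c r w :: real
  assumes "0 \<le> c" "0 \<le> r" "a\<^sup>2 \<le> w" "w \<le> r\<^sup>2 + 2 * c * (r + a)"
  shows "w \<le> (r + 2 * c)\<^sup>2"
proof -
  have "a \<le> r + 2 * c"
  proof (rule ccontr)
    assume "\<not> a \<le> r + 2 * c"
    then have "(r + 2 * c) * r \<le> a * (a - 2 * c)" "0 < (a - r - 2 * c) * (a + r)"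
      using assms(1,2) by (auto intro!: mult_mono mult_pos_pos)
    with assms(3,4) show False by (simp add: power2_eq_square algebra_simps)
  qed
  then have "2 * c * (r + a) \<le> 2 * c * (r + (r + 2 * c))"
    using assms(1) by (intro mult_left_mono) auto
  with assms(4) show ?thesis by (simp add: power2_eq_square algebra_simps)
qed

text \<open>In the application \<open>N\<close> is the norm of \<open>Q_hat\<close> and \<open>\<eta>\<close> is \<open>M\<close> times the error bound;
  \<open>F\<close> and \<open>Fs\<close> are the real values of \<open>\<Phi>\<close>, which is finite at all iterates.\<close>

locale inexact_apg =
  fixes \<Phi> :: "'a::real_vector \<Rightarrow> ereal" and N :: "'a \<Rightarrow> real"
    and x xt :: "nat \<Rightarrow> 'a" and t \<eta> F :: "nat \<Rightarrow> real" and xs :: 'a and Fs :: real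
  assumes \<Phi>_convex: "\<And>u v a b c. \<lbrakk>\<Phi> u \<le> ereal a; \<Phi> v \<le> ereal b; 0 \<le> c; c \<le> 1\<rbrakk> \<Longrightarrow>
      \<Phi> ((1 - c) *\<^sub>R u + c *\<^sub>R v) \<le> ereal ((1 - c) * a + c * b)"
    and N_scale: "\<And>c u. N (c *\<^sub>R u) = \<bar>c\<bar> * N u"
    and N_triangle: "\<And>u v. N (u + v) \<le> N u + N v"
    and N_nonneg: "\<And>u. 0 \<le> N u"
    and \<Phi>_x: "\<And>k. \<Phi> (x k) = ereal (F k)" and \<Phi>_xs: "\<Phi> xs = ereal Fs"
    and Fs_le: "\<And>k. Fs \<le> F k"
    and \<eta>_nonneg: "\<And>k. 0 \<le> \<eta> (Suc k)"
    and t_1: "t 1 = 1" and t_ge_1: "\<And>k. 1 \<le> t (Suc k)"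
    and xt_Suc: "\<And>k. xt (Suc k) = x k + ((t k - 1) / t (Suc k)) *\<^sub>R (x k - x (k - 1))"
    and step: "\<And>k z v. \<Phi> z \<le> ereal v \<Longrightarrow>
      F (Suc k) + (N (z - x (Suc k)))\<^sup>2 / 2
        \<le> v + (N (z - xt (Suc k)))\<^sup>2 / 2 + \<eta> (Suc k) / t (Suc k) * N (z - x (Suc k))"
begin

lemma N_minus: "N (u - v) = N (v - u)"
  using N_scale[of "-1" "u - v"] by simp

text \<open>The potential is \<open>2 * E k + (N (u k))\<^sup>2\<close>, and \<open>r k\<close>
  bounds its square root by induction.\<close>

lemma accelerated_bound:
  assumes t_le: "\<And>k. k \<ge> 1 \<Longrightarrow> (t (Suc k))\<^sup>2 - t (Suc k) \<le> (t k)\<^sup>2" and "k \<ge> 1"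
  shows "(t k)\<^sup>2 * (F k - Fs) \<le> (N (x 0 - xs) + 2 * (\<Sum>i=1..k. \<eta> i))\<^sup>2 / 2"
proof -
  \<comment> \<open>At index 0 the difference is \<open>x 0 - x 0\<close>, so
    \<open>u 0 = x 0 - xs\<close> whatever \<open>t 0\<close> is. As \<open>t 0\<close> is
    unconstrained, \<open>E 0\<close> is set to 0 separately.\<close>
  define u where "u k = x k + (t k - 1) *\<^sub>R (x k - x (k - 1)) - xs" for k
  define E where "E k = (if k = 0 then 0 else (t k)\<^sup>2 * (F k - Fs))" for k
  define r where "r k = N (x 0 - xs) + 2 * (\<Sum>i=1..k. \<eta> i)" for k
  have E_nonneg: "0 \<le> E k" for k using Fs_le[of k] by (simp add: E_def)
  have r_nonneg: "0 \<le> r k" for k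
    unfolding r_def using \<eta>_nonneg N_nonneg
    by (intro add_nonneg_nonneg mult_nonneg_nonneg sum_nonneg) (auto simp: Suc_le_eq gr0_conv_Suc)
  have rec: "2 * E (Suc k) + (N (u (Suc k)))\<^sup>2 \<le> 2 * E k + (N (u k))\<^sup>2 + 2 * \<eta> (Suc k) * N (u (Suc k))"
    for k
  proof -
    define \<tau> where "\<tau> = t (Suc k)"
    have \<tau>: "\<tau> \<ge> 1" "\<tau> \<noteq> 0" using t_ge_1[of k] by (auto simp: \<tau>_def)
    \<comment> \<open>With this weight, \<open>x (Suc k) - z\<close> and
      \<open>xt (Suc k) - z\<close> are the vectors \<open>u (Suc k)\<close> and \<open>u k\<close>
      divided by \<open>\<tau>\<close>, so the step inequality at \<open>z\<close> compares
      consecutive potentials.\<close>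
    define c where "c = 1 / \<tau>"
    have c: "0 \<le> c" "c \<le> 1" "\<tau> * c = 1" using \<tau> by (auto simp: c_def)
    define z where "z = (1 - c) *\<^sub>R x k + c *\<^sub>R xs"
    have z: "\<Phi> z \<le> ereal ((1 - c) * F k + c * Fs)"
      unfolding z_def using \<Phi>_convex c \<Phi>_x \<Phi>_xs by simp
    have "u (Suc k) = \<tau> *\<^sub>R (x (Suc k) - z)"
      using c(3) by (simp add: z_def u_def \<tau>_def[symmetric] algebra_simps)
    then have 1: "N (u (Suc k)) = \<tau> * N (z - x (Suc k))"
      using \<tau> by (simp add: N_scale N_minus[of z])
    have "u k = \<tau> *\<^sub>R (xt (Suc k) - z)"
    proof -
      have "\<tau> *\<^sub>R xt (Suc k) = \<tau> *\<^sub>R x k + (t k - 1) *\<^sub>R (x k - x (k - 1))"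
        using \<tau> by (simp add: xt_Suc \<tau>_def[symmetric] scaleR_right_distrib)
      then show ?thesis
        using c(3) by (simp add: z_def u_def algebra_simps)
    qed
    then have 2: "N (u k) = \<tau> * N (z - xt (Suc k))"
      using \<tau> by (simp add: N_scale N_minus[of z])
    \<comment> \<open>This is where the growth condition on \<open>t\<close> enters; for
      \<open>k = 0\<close> the factor is 0 because \<open>t 1 = 1\<close>.\<close>
    have "(\<tau>\<^sup>2 - \<tau>) * (F k - Fs) \<le> E k"
    proof (cases "k = 0")
      case True
      then show ?thesis using t_1 by (simp add: E_def \<tau>_def)
    next
      case False
      then show ?thesis using t_le[of k] Fs_le[of k] by (auto simp: E_def \<tau>_def intro: mult_right_mono)
    qed
    moreover
    \<comment> \<open>The factor turns distances from \<open>z\<close> into norms of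
      \<open>u\<close>. The error was divided by \<open>\<tau>\<close>, so it becomes
      \<open>2 * \<eta> (Suc k) * N (u (Suc k))\<close>, with no growing weight.\<close>
    have *: "2 * \<tau>\<^sup>2 * (F (Suc k) + (N (z - x (Suc k)))\<^sup>2 / 2)
      \<le> 2 * \<tau>\<^sup>2 * ((1 - c) * F k + c * Fs + (N (z - xt (Suc k)))\<^sup>2 / 2 + \<eta> (Suc k) * c * N (z - x (Suc k)))"
      using step[OF z, of k] by (intro mult_left_mono) (auto simp: c_def \<tau>_def)
    have "2 * \<tau>\<^sup>2 * F (Suc k) + (N (u (Suc k)))\<^sup>2
      \<le> 2 * ((\<tau>\<^sup>2 - \<tau>) * F k + \<tau> * Fs) + (N (u k))\<^sup>2 + 2 * \<eta> (Suc k) * N (u (Suc k))"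
    proof -
      have key: "2 * \<tau>\<^sup>2 * ((1 - c) * F k + c * Fs + a / 2 + h * c * n)
          = 2 * ((\<tau>\<^sup>2 - \<tau>) * F k + \<tau> * Fs) + \<tau>\<^sup>2 * a + 2 * h * (\<tau> * n)" for a h n
        using \<tau> by (simp add: c_def field_simps power2_eq_square)
      then show ?thesis
        using *[unfolded key] unfolding 1 2 by (simp add: power_mult_distrib distrib_left)
    qed
    moreover have "E (Suc k) = \<tau>\<^sup>2 * (F (Suc k) - Fs)" by (simp add: E_def \<tau>_def)
    ultimately show ?thesis by (simp add: algebra_simps)
  qed
  have "2 * E k + (N (u k))\<^sup>2 \<le> (r k)\<^sup>2" for k
  proof (induction k)
    case 0
    then show ?case by (simp add: E_def r_def u_def)
  next
    case (Suc k)
    have "0 \<le> \<eta> (Suc k) * r k" using \<eta>_nonneg r_nonneg by simp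
    then have "2 * E (Suc k) + (N (u (Suc k)))\<^sup>2 \<le> (r k)\<^sup>2 + 2 * \<eta> (Suc k) * (r k + N (u (Suc k)))"
      using rec[of k] Suc by (simp add: algebra_simps)
    then have "2 * E (Suc k) + (N (u (Suc k)))\<^sup>2 \<le> (r k + 2 * \<eta> (Suc k))\<^sup>2"
      using E_nonneg[of "Suc k"] \<eta>_nonneg r_nonneg
      by (intro perturbed_square_recursion[where a = "N (u (Suc k))"]) auto
    then show ?case by (simp add: r_def algebra_simps)
  qed
  from this[of k] have "2 * E k \<le> (r k)\<^sup>2" by (smt (verit) zero_le_power2)
  then show ?thesis using \<open>k \<ge> 1\<close> by (simp add: E_def r_def)
qed

text \<open>The potential is \<open>2 * (real k * (F k - Fs)) + (a k)\<^sup>2\<close>. The step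
  inequality is used at \<open>xs\<close> once and at \<open>x k\<close> with weight
  \<open>k\<close>; this weight is why the errors are summed with the factor
  \<open>i\<close>.\<close>

lemma constant_step_bound:
  assumes t: "\<And>k. t (Suc k) = 1"
  shows "real k * (F k - Fs) \<le> (N (x 0 - xs) + 2 * (\<Sum>i=1..k. real i * \<eta> i))\<^sup>2 / 2"
proof -
  define r where "r k = N (x 0 - xs) + 2 * (\<Sum>i=1..k. real i * \<eta> i)" for k
  define a where "a k = N (x k - xs)" for k
  have r_nonneg: "0 \<le> r k" for k
    unfolding r_def using \<eta>_nonneg N_nonneg
    by (intro add_nonneg_nonneg mult_nonneg_nonneg sum_nonneg) (auto simp: Suc_le_eq gr0_conv_Suc)
  have a_nonneg: "0 \<le> a k" for k by (simp add: a_def N_nonneg)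
  have xt: "xt (Suc k) = x k" for k
    using t by (cases k) (simp_all add: xt_Suc)
  have gap: "0 \<le> real k * (F k - Fs)" for k using Fs_le[of k] by simp
  have rec: "2 * (real (Suc k) * (F (Suc k) - Fs)) + (a (Suc k))\<^sup>2
    \<le> 2 * (real k * (F k - Fs)) + (a k)\<^sup>2 + 2 * (real (Suc k) * \<eta> (Suc k)) * (a k + a (Suc k))" for k
  proof -
    have "F (Suc k) + (a (Suc k))\<^sup>2 / 2 \<le> Fs + (a k)\<^sup>2 / 2 + \<eta> (Suc k) * a (Suc k)"
      using step[of xs Fs k] by (simp add: t xt \<Phi>_xs a_def N_minus[of xs])
    moreover have "0 \<le> \<eta> (Suc k) * a k" using \<eta>_nonneg a_nonneg by simp
    moreover have "real k * F (Suc k) \<le> real k * (F k + \<eta> (Suc k) * (a k + a (Suc k)))"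
    proof (rule mult_left_mono)
      have "N (x k - x (Suc k)) \<le> a k + a (Suc k)"
        using N_triangle[of "x k - xs" "xs - x (Suc k)"] by (simp add: a_def N_minus[of xs])
      \<comment> \<open>Passing through \<open>xs\<close> expresses the error in terms of distances
        that the potential controls.\<close>
      then have "\<eta> (Suc k) * N (x k - x (Suc k)) \<le> \<eta> (Suc k) * (a k + a (Suc k))"
        using \<eta>_nonneg by (rule mult_left_mono)
      moreover have "N 0 = 0" using N_scale[of 0 0] by simp
      then have "F (Suc k) + (N (x k - x (Suc k)))\<^sup>2 / 2 \<le> F k + \<eta> (Suc k) * N (x k - x (Suc k))"
        using step[of "x k" "F k" k] by (simp add: t xt \<Phi>_x)
      ultimately show "F (Suc k) \<le> F k + \<eta> (Suc k) * (a k + a (Suc k))"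
        by (smt (verit) zero_le_power2 divide_nonneg_nonneg)
    qed simp
    ultimately show ?thesis by (simp add: algebra_simps)
  qed
  have "2 * (real k * (F k - Fs)) + (a k)\<^sup>2 \<le> (r k)\<^sup>2" for k
  proof (induction k)
    case 0
    then show ?case by (simp add: a_def r_def)
  next
    case (Suc k)
    let ?c = "real (Suc k) * \<eta> (Suc k)"
    have c: "0 \<le> ?c" using \<eta>_nonneg by simp
    \<comment> \<open>The induction hypothesis also bounds the old distance by \<open>r k\<close>,
      which brings the error into the form required by
      \<open>perturbed_square_recursion\<close>.\<close>
    have "(a k)\<^sup>2 \<le> (r k)\<^sup>2" using Suc gap[of k] by linarith
    then have "a k \<le> r k" using r_nonneg by (rule power2_le_imp_le)
    then have "2 * ?c * (a k + a (Suc k)) \<le> 2 * ?c * (r k + a (Suc k))"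
      using c by (intro mult_left_mono) auto
    then have "2 * (real (Suc k) * (F (Suc k) - Fs)) + (a (Suc k))\<^sup>2
        \<le> (r k)\<^sup>2 + 2 * ?c * (r k + a (Suc k))"
      using rec[of k] Suc by linarith
    then have "2 * (real (Suc k) * (F (Suc k) - Fs)) + (a (Suc k))\<^sup>2 \<le> (r k + 2 * ?c)\<^sup>2"
      using gap[of "Suc k"] c r_nonneg
      by (intro perturbed_square_recursion[where a = "a (Suc k)"]) auto
    then show ?case by (simp add: r_def algebra_simps)
  qed
  from this[of k] have "2 * (real k * (F k - Fs)) \<le> (r k)\<^sup>2" by (smt (verit) zero_le_power2)
  then show ?thesis by (simp add: r_def)
qed

end

text \<open>Dropping the 1 under the root shows that each step increases \<open>t\<close> by at
  least 1/2.\<close>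

lemma fista_parameter_ge:
  fixes t :: "nat \<Rightarrow> real"
  assumes "t 1 = 1" and "\<And>k. k \<ge> 1 \<Longrightarrow> t (k + 1) = (1 + sqrt (1 + 4 * (t k)\<^sup>2)) / 2"
    and "k \<ge> 1"
  shows "(real k + 1) / 2 \<le> t k"
  using \<open>k \<ge> 1\<close>
proof (induction k rule: dec_induct)
  case (step k)
  have "2 * t k \<le> sqrt (1 + 4 * (t k)\<^sup>2)"
    by (rule real_le_rsqrt) (simp add: power_mult_distrib)
  with step assms(2)[of k] show ?case by simp
qed (use assms(1) in simp)

section \<open>The block symmetric Gauss-Seidel operator\<close>

text \<open>The vector is split into its block restrictions \<open>r i\<close>. The form of the
  block diagonal part is the sum of the forms of \<open>Q\<close> at these restrictions, and a block
  where \<open>x\<close> is nonzero contributes a positive term.\<close>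

lemma diag_part_pd:
  fixes Q :: "real^'n^'n" and blk :: "'n \<Rightarrow> nat"
  assumes pd: "\<And>i. i \<in> range blk \<Longrightarrow> diag_block_pd blk Q i" and "x \<noteq> 0"
  shows "0 < x \<bullet> (diag_part blk Q *v x)"
proof -
  define r where "r i = (\<chi> k. if blk k = i then x $ k else 0)" for i
  define I where "I = range blk"
  have "finite I" by (simp add: I_def)
  have nz: "0 < r i \<bullet> (Q *v r i)" if "i \<in> I" "r i \<noteq> 0" for i
    using pd[of i] that by (auto simp: diag_block_pd_def I_def r_def)
  have "(\<Sum>i\<in>I. r i \<bullet> (Q *v r i))
      = (\<Sum>k\<in>UNIV. \<Sum>i\<in>I. if i = blk k then x $ k * (Q *v r i) $ k else 0)"
    unfolding inner_vec_def
    by (subst sum.swap) (auto simp: r_def intro!: sum.cong)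
  also have "\<dots> = (\<Sum>k\<in>UNIV. x $ k * (Q *v r (blk k)) $ k)"
    using \<open>finite I\<close> by (simp add: I_def)
  also have "\<dots> = x \<bullet> (diag_part blk Q *v x)"
  proof -
    have "(Q *v r (blk k)) $ k = (diag_part blk Q *v x) $ k" for k
      by (auto simp: matrix_vector_mult_def diag_part_def r_def intro!: sum.cong)
    then show ?thesis by (simp add: inner_vec_def)
  qed
  finally have eq: "x \<bullet> (diag_part blk Q *v x) = (\<Sum>i\<in>I. r i \<bullet> (Q *v r i))" by simp
  from \<open>x \<noteq> 0\<close> obtain k where "x $ k \<noteq> 0" by (auto simp: vec_eq_iff)
  then have "r (blk k) $ k \<noteq> 0" by (simp add: r_def)
  then have "r (blk k) \<noteq> 0" by (metis zero_index)
  show ?thesis unfolding eq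
  proof (rule sum_pos2[OF \<open>finite I\<close>])
    show "blk k \<in> I" by (simp add: I_def)
    then show "0 < r (blk k) \<bullet> (Q *v r (blk k))" using nz \<open>r (blk k) \<noteq> 0\<close> by blast
    show "0 \<le> r i \<bullet> (Q *v r i)" if "i \<in> I" for i
      using nz[OF that] by (cases "r i = 0") auto
  qed
qed

lemma upper_diag_decomposition:
  assumes "transpose Q = Q"
  shows "Q = upper_part blk Q + diag_part blk Q + transpose (upper_part blk Q)"
proof -
  have "Q $ k $ l = Q $ l $ k" for k l using assms by (metis transpose_def vec_lambda_beta)
  then show ?thesis
    by (auto simp: vec_eq_iff upper_part_def diag_part_def transpose_def)
qed

lemma transpose_add: "transpose (A + B) = transpose A + transpose B"
  by (simp add: transpose_def vec_eq_iff)

text \<open>This transfers homogeneity and the triangle inequality from the Euclidean norm to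
  \<open>wnorm\<close>.\<close>

lemma wnorm_eq_norm_psd_sqrt:
  assumes "psd A"
  shows "wnorm A x = norm (psd_sqrt A *v x)"
proof -
  have "(psd_sqrt A *v x) \<bullet> (psd_sqrt A *v x) = x \<bullet> (A *v x)"
    using psd_sqrt[OF assms] by (simp add: psd_def inner_symmetric_matrix matrix_vector_mul_assoc)
  then show ?thesis by (simp add: wnorm_def norm_eq_sqrt_inner)
qed

lemma wnorm_power2:
  assumes "psd A"
  shows "(wnorm A x)\<^sup>2 = x \<bullet> (A *v x)"
  using assms by (simp add: wnorm_def psd_def)

lemma spectral_norm_bound: "norm (A *v x) \<le> spectral_norm A * norm x"
  unfolding spectral_norm_def by (rule onorm) simp

lemma spectral_norm_nonneg: "0 \<le> spectral_norm A"
  unfolding spectral_norm_def by (rule onorm_pos_le) simp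

lemma M_const_nonneg: "0 \<le> M_const blk Q"
  by (simp add: M_const_def spectral_norm_nonneg)

section \<open>Factorization of \<open>Q_hat\<close> and the bound on the error term\<close>

locale block_matrix =
  fixes blk :: "'n::finite \<Rightarrow> nat" and Q :: "real^'n^'n"
  assumes psd_Q: "psd Q" and pd_blocks: "\<And>i. i \<in> range blk \<Longrightarrow> diag_block_pd blk Q i"
begin

abbreviation "U \<equiv> upper_part blk Q"
abbreviation "D \<equiv> diag_part blk Q"
abbreviation "H \<equiv> Q_hat blk Q"

lemma D_sym: "transpose D = D"
proof -
  have "transpose Q = Q" using psd_Q by (simp add: psd_def)
  then have "Q $ k $ l = Q $ l $ k" for k l by (metis transpose_def vec_lambda_beta)
  then show ?thesis by (auto simp: vec_eq_iff diag_part_def transpose_def)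
qed

lemmas D_facts = inv_sqrt_pd[OF D_sym diag_part_pd[OF pd_blocks]]

lemma inner_D_inv: "y \<bullet> (matrix_inv D *v z) = (inv_sqrt D *v y) \<bullet> (inv_sqrt D *v z)"
  using D_facts(1,2) by (simp add: inner_symmetric_matrix matrix_vector_mul_assoc)

lemma D_cancel: "D *v (matrix_inv D *v z) = z" "matrix_inv D *v (D *v z) = z"
  using D_facts(3,4) by (simp_all add: matrix_vector_mul_assoc)

lemma D_inv_sym: "transpose (matrix_inv D) = matrix_inv D"
  using D_facts(1,2) by (metis matrix_transpose_mul)

lemma inner_sGS_op: "x \<bullet> (sGS_op blk Q *v x) = (norm (inv_sqrt D *v (transpose U *v x)))\<^sup>2"
proof -
  have "x \<bullet> (sGS_op blk Q *v x) = (transpose U *v x) \<bullet> (matrix_inv D *v (transpose U *v x))"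
    by (simp add: sGS_op_def dot_lmul_matrix flip: matrix_vector_mul_assoc)
  then show ?thesis by (simp add: inner_D_inv power2_norm_eq_inner)
qed

lemma psd_sGS_op: "psd (sGS_op blk Q)"
  unfolding psd_def
proof
  show "transpose (sGS_op blk Q) = sGS_op blk Q"
    by (simp add: sGS_op_def matrix_transpose_mul D_inv_sym matrix_mul_assoc)
qed (simp add: inner_sGS_op)

lemma inner_Q: "x \<bullet> (Q *v x) = x \<bullet> (D *v x) + 2 * (x \<bullet> (transpose U *v x))"
proof -
  have "x \<bullet> (Q *v x) = x \<bullet> ((U + D + transpose U) *v x)"
    using upper_diag_decomposition[of Q blk] psd_Q by (simp add: psd_def)
  also have "\<dots> = x \<bullet> (U *v x) + x \<bullet> (D *v x) + x \<bullet> (transpose U *v x)"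
    by (simp add: matrix_vector_mult_add_rdistrib inner_add_right)
  also have "x \<bullet> (U *v x) = x \<bullet> (transpose U *v x)"
    using dot_lmul_matrix[of x U x] by (simp add: inner_commute)
  finally show ?thesis by simp
qed

lemma inner_Q_hat: "x \<bullet> (H *v x) = x \<bullet> (Q *v x) + x \<bullet> (sGS_op blk Q *v x)"
  by (simp add: Q_hat_def matrix_vector_mult_add_rdistrib inner_add_right)

text \<open>This is the quadratic form of H = (D + U) D^-1 (D + U^T). On expansion, \<open>D\<close>
  cancels its inverse in the two cross terms, which leaves twice the form of U^T.\<close>

lemma inner_Q_hat_factored: "x \<bullet> (H *v x) = (norm (inv_sqrt D *v ((D + transpose U) *v x)))\<^sup>2"
proof -
  let ?y = "transpose U *v x"
  have "(norm (inv_sqrt D *v ((D + transpose U) *v x)))\<^sup>2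
      = (D *v x + ?y) \<bullet> (matrix_inv D *v (D *v x + ?y))"
    by (simp add: matrix_vector_mult_add_rdistrib inner_D_inv power2_norm_eq_inner)
  also have "\<dots> = x \<bullet> (D *v x) + 2 * (x \<bullet> ?y) + ?y \<bullet> (matrix_inv D *v ?y)"
    using inner_symmetric_matrix[OF D_sym, of x "matrix_inv D *v ?y"]
    by (simp add: matrix_vector_right_distrib D_cancel inner_add_left inner_add_right inner_commute)
  finally show ?thesis
    by (simp add: inner_Q_hat inner_Q inner_sGS_op inner_D_inv power2_norm_eq_inner)
qed

lemma psd_H: "psd H"
proof -
  have "transpose H = H"
    using psd_Q psd_sGS_op by (simp add: Q_hat_def transpose_add psd_def)
  then show ?thesis by (simp add: psd_def inner_Q_hat_factored)
qed

text \<open>If the form of \<open>H\<close> vanishes, so do its two nonnegative parts. The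
  Gauss-Seidel part forces \<open>transpose U *v x = 0\<close>, and then the form of
  \<open>Q\<close> reduces to that of \<open>D\<close>, which is positive.\<close>

lemma H_pd:
  assumes "x \<noteq> 0"
  shows "0 < x \<bullet> (H *v x)"
proof (rule ccontr)
  assume "\<not> 0 < x \<bullet> (H *v x)"
  moreover have "0 \<le> x \<bullet> (Q *v x)" "0 \<le> x \<bullet> (sGS_op blk Q *v x)"
    using psd_Q psd_sGS_op by (auto simp: psd_def)
  ultimately have 0: "x \<bullet> (Q *v x) = 0" "x \<bullet> (sGS_op blk Q *v x) = 0"
    unfolding inner_Q_hat by linarith+
  let ?y = "transpose U *v x"
  have "?y \<bullet> (matrix_inv D *v ?y) = 0"
    using 0(2) by (simp add: inner_sGS_op inner_D_inv)
  then have "(matrix_inv D *v ?y) \<bullet> (D *v (matrix_inv D *v ?y)) = 0"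
    by (simp add: D_cancel inner_commute)
  then have "matrix_inv D *v ?y = 0"
    using diag_part_pd[OF pd_blocks, of "matrix_inv D *v ?y"] by fastforce
  then have "?y = 0" using D_cancel(1)[of ?y] by simp
  then have "x \<bullet> (D *v x) = 0" using 0(1) inner_Q[of x] by simp
  then show False using diag_part_pd[OF pd_blocks assms] by simp
qed

lemmas H_facts = inv_sqrt_pd[OF conjunct1[OF psd_H[unfolded psd_def]] H_pd]

text \<open>The factorization \<open>H = (D + U) D\<^sup>-\<^sup>1 (D + U\<^sup>*)\<close> makes \<open>H\<^sup>-\<^sup>1\<^sup>/\<^sup>2 (D + U) D\<^sup>-\<^sup>1\<^sup>/\<^sup>2\<close>
  orthogonal, and \<open>\<Delta> = (D + U) D\<^sup>-\<^sup>1 (\<delta> - \<delta>') + \<delta>'\<close>.\<close>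

lemma inner_Delta_le:
  assumes "norm d' \<le> r" "norm d \<le> r"
  shows "\<bar>w \<bullet> Delta blk Q d' d\<bar> \<le> M_const blk Q * r * wnorm H w"
proof -
  let ?\<eta> = "d - d'"
  have "w \<bullet> Delta blk Q d' d = w \<bullet> d' + (w \<bullet> ?\<eta> + w \<bullet> (U *v (matrix_inv D *v ?\<eta>)))"
    by (simp add: Delta_def inner_add_right inner_diff_right flip: matrix_vector_mul_assoc)
  also have "w \<bullet> ?\<eta> + w \<bullet> (U *v (matrix_inv D *v ?\<eta>))
      = ((D + transpose U) *v w) \<bullet> (matrix_inv D *v ?\<eta>)"
    by (simp add: matrix_vector_mult_add_rdistrib inner_add_left dot_lmul_matrix
        inner_symmetric_matrix[OF D_sym] D_cancel)
  finally have split: "w \<bullet> Delta blk Q d' d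
      = w \<bullet> d' + (inv_sqrt D *v ((D + transpose U) *v w)) \<bullet> (inv_sqrt D *v ?\<eta>)"
    by (simp add: inner_D_inv)
  have W: "norm (inv_sqrt D *v ((D + transpose U) *v w)) = wnorm H w"
    by (simp add: wnorm_def inner_Q_hat_factored)
  have "0 \<le> wnorm H w" by (simp flip: W)
  have "\<bar>w \<bullet> d'\<bar> \<le> wnorm H w * norm (inv_sqrt H *v d')" by (rule H_facts(5))
  also have "\<dots> \<le> wnorm H w * (spectral_norm (inv_sqrt H) * r)"
    using assms(1) \<open>0 \<le> wnorm H w\<close> spectral_norm_nonneg
    by (intro mult_left_mono order_trans[OF spectral_norm_bound])
  finally have 1: "\<bar>w \<bullet> d'\<bar> \<le> wnorm H w * (spectral_norm (inv_sqrt H) * r)" .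
  \<comment> \<open>The difference of two errors of size \<open>r\<close> is the source of the
    factor 2 in \<open>M_const\<close>.\<close>
  have "norm ?\<eta> \<le> 2 * r" using norm_triangle_ineq4[of d d'] assms by linarith
  have "\<bar>(inv_sqrt D *v ((D + transpose U) *v w)) \<bullet> (inv_sqrt D *v ?\<eta>)\<bar>
      \<le> wnorm H w * norm (inv_sqrt D *v ?\<eta>)"
    using Cauchy_Schwarz_ineq2 by (metis W)
  also have "\<dots> \<le> wnorm H w * (spectral_norm (inv_sqrt D) * (2 * r))"
    using \<open>norm ?\<eta> \<le> 2 * r\<close> \<open>0 \<le> wnorm H w\<close> spectral_norm_nonneg
    by (intro mult_left_mono order_trans[OF spectral_norm_bound])
  finally show ?thesis using 1 unfolding split M_const_def by (simp add: algebra_simps)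
qed

end

section \<open>Convexity along segments and growth at a minimizer\<close>

lemma psd_quadratic_interpolation:
  assumes "psd A"
  shows "((1 - c) *\<^sub>R y + c *\<^sub>R z) \<bullet> (A *v ((1 - c) *\<^sub>R y + c *\<^sub>R z))
    = (1 - c) * (y \<bullet> (A *v y)) + c * (z \<bullet> (A *v z)) - c * (1 - c) * ((z - y) \<bullet> (A *v (z - y)))"
proof -
  have "z \<bullet> (A *v y) = y \<bullet> (A *v z)"
    using inner_symmetric_matrix[of A y z] assms by (simp add: psd_def inner_commute)
  then show ?thesis
    by (simp add: matrix_vector_right_distrib matrix_vector_mult_diff_distrib
        matrix_vector_mult_scaleR inner_add_left inner_add_right inner_diff_left inner_diff_right
        algebra_simps)
qed

lemma quad_interpolation:
  assumes "psd A"
  shows "quad A b ((1 - c) *\<^sub>R y + c *\<^sub>R z)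
    = (1 - c) * quad A b y + c * quad A b z - c * (1 - c) / 2 * ((z - y) \<bullet> (A *v (z - y)))"
  unfolding quad_def psd_quadratic_interpolation[OF assms]
  by (simp add: inner_add_right diff_divide_distrib add_divide_distrib algebra_simps)

text \<open>Convexity of the epigraph, stated with real upper bounds so that no arithmetic with
  infinite values arises.\<close>

lemma proper_closed_convex_interpolation:
  assumes "proper_closed_convex p" "p u \<le> ereal a" "p v \<le> ereal b" "0 \<le> c" "c \<le> 1"
  shows "p ((1 - c) *\<^sub>R u + c *\<^sub>R v) \<le> ereal ((1 - c) * a + c * b)"
proof -
  have "(1 - c) *\<^sub>R (u, a) + c *\<^sub>R (v, b) \<in> ereal_epigraph p"
    using assms by (intro convexD) (auto simp: proper_closed_convex_def ereal_epigraph_def)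
  then show ?thesis by (simp add: ereal_epigraph_def)
qed

lemma first_block_interpolation:
  "first_block e (a *\<^sub>R u + c *\<^sub>R v) = a *\<^sub>R first_block e u + c *\<^sub>R first_block e v"
  by (simp add: first_block_def vec_eq_iff)

lemma ereal_plus_le_iff: "p + ereal a \<le> ereal b \<longleftrightarrow> p \<le> ereal (b - a)"
  by (cases p) auto

lemma objective_le_iff: "objective e p Q b z \<le> ereal v \<longleftrightarrow> p (first_block e z) \<le> ereal (v - quad Q b z)"
  by (simp add: objective_def ereal_plus_le_iff)

lemma objective_convex:
  assumes "psd Q" "proper_closed_convex p"
    and "objective e p Q b u \<le> ereal \<alpha>" "objective e p Q b v \<le> ereal \<beta>" "0 \<le> c" "c \<le> 1"
  shows "objective e p Q b ((1 - c) *\<^sub>R u + c *\<^sub>R v) \<le> ereal ((1 - c) * \<alpha> + c * \<beta>)"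
proof -
  have "p (first_block e ((1 - c) *\<^sub>R u + c *\<^sub>R v))
      \<le> ereal ((1 - c) * (\<alpha> - quad Q b u) + c * (\<beta> - quad Q b v))"
    unfolding first_block_interpolation
    using assms by (intro proper_closed_convex_interpolation) (auto simp: objective_le_iff)
  also have "\<dots> \<le> ereal ((1 - c) * \<alpha> + c * \<beta> - quad Q b ((1 - c) *\<^sub>R u + c *\<^sub>R v))"
  proof -
    have "0 \<le> c * (1 - c) / 2 * ((v - u) \<bullet> (Q *v (v - u)))"
      using assms(1,5,6) by (simp add: psd_def)
    then show ?thesis unfolding quad_interpolation[OF assms(1)] by (simp add: algebra_simps)
  qed
  finally show ?thesis by (simp add: objective_le_iff)
qed

text \<open>Compare the minimizer \<open>y\<close> of \<open>\<Phi>\<close> plus \<open>g\<close>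
  with the point at fraction \<open>c\<close> of the way to \<open>z\<close>, divide by
  \<open>c\<close> and let \<open>c\<close> tend to 0 from above. The curvature term
  \<open>K\<close> of \<open>g\<close> survives in the limit.\<close>

lemma minimizer_quadratic_growth:
  fixes \<Phi> :: "'a::real_vector \<Rightarrow> ereal" and g :: "'a \<Rightarrow> real"
  assumes conv: "\<And>c. \<lbrakk>0 \<le> c; c \<le> 1\<rbrakk> \<Longrightarrow> \<Phi> ((1 - c) *\<^sub>R y + c *\<^sub>R z) \<le> ereal ((1 - c) * a + c * v)"
    and g: "\<And>c. g ((1 - c) *\<^sub>R y + c *\<^sub>R z) = (1 - c) * g y + c * g z - c * (1 - c) * K"
    and min: "\<And>w. ereal (a + g y) \<le> \<Phi> w + ereal (g w)"
  shows "a + g y + K \<le> v + g z"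
proof (rule tendsto_upperbound)
  show "((\<lambda>c. a + g y + (1 - c) * K) \<longlongrightarrow> a + g y + K) (at_right 0)"
    by (auto intro!: tendsto_eq_intros)
  have "a + g y + (1 - c) * K \<le> v + g z" if "0 < c" "c < 1" for c
  proof -
    let ?w = "(1 - c) *\<^sub>R y + c *\<^sub>R z"
    have "ereal (a + g y) \<le> ereal ((1 - c) * a + c * v) + ereal (g ?w)"
      using min[of ?w] conv[of c] that by (meson add_right_mono less_imp_le order_trans)
    then have "c * (a + g y + (1 - c) * K) \<le> c * (v + g z)"
      unfolding g by (simp add: algebra_simps)
    then show ?thesis using that by simp
  qed
  then show "\<forall>\<^sub>F c in at_right 0. a + g y + (1 - c) * K \<le> v + g z"
    using eventually_at_right_less[of 0] eventually_at_right_real[of 0 1]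
    by (auto elim!: eventually_mono)
qed simp

section \<open>Convergence of the inexact sGS iteration\<close>

text \<open>The smooth part of the Step 1 objective is quadratic with Hessian Q + T = H, where T is
  \<open>sGS_op blk Q\<close>, so its minimizer has quadratic growth in the norm of
  \<open>H\<close>. The linear error term is then estimated by
  \<open>inner_Delta_le\<close>.\<close>

lemma (in block_matrix) inexact_step:
  fixes p :: "real^'m \<Rightarrow> ereal"
  assumes p: "proper_closed_convex p"
    and min: "is_arg_min (\<lambda>z. p (first_block e z) +
       ereal (quad Q b z + 1/2 * (wnorm (sGS_op blk Q) (z - xt))\<^sup>2 - z \<bullet> Delta blk Q d' d)) (\<lambda>z. True) y"
    and d: "norm d' \<le> r" "norm d \<le> r"
    and y: "objective e p Q b y = ereal f" and z: "objective e p Q b z \<le> ereal v"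
  shows "f + (wnorm H (z - y))\<^sup>2 / 2 \<le> v + (wnorm H (z - xt))\<^sup>2 / 2 + M_const blk Q * r * wnorm H (z - y)"
proof -
  let ?T = "sGS_op blk Q" and ?\<Delta> = "Delta blk Q d' d"
  let ?qT = "\<lambda>z. z \<bullet> (?T *v z)" and ?qH = "\<lambda>z. z \<bullet> (H *v z)"
  define g where "g z = quad Q b z + 1/2 * (wnorm ?T (z - xt))\<^sup>2 - z \<bullet> ?\<Delta>" for z
  have g: "g z = quad Q b z + 1/2 * ?qT (z - xt) - z \<bullet> ?\<Delta>" for z
    unfolding g_def wnorm_power2[OF psd_sGS_op] ..
  have Py: "p (first_block e y) = ereal (f - quad Q b y)"
    using y unfolding objective_def by (cases "p (first_block e y)") auto
  have Pz: "p (first_block e z) \<le> ereal (v - quad Q b z)"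
    using z by (simp add: objective_le_iff)
  have "f - quad Q b y + g y + ?qH (z - y) / 2 \<le> v - quad Q b z + g z"
  proof (rule minimizer_quadratic_growth[where \<Phi> = "\<lambda>w. p (first_block e w)"])
    show "p (first_block e ((1 - c) *\<^sub>R y + c *\<^sub>R z)) \<le> ereal ((1 - c) * (f - quad Q b y) + c * (v - quad Q b z))"
      if "0 \<le> c" "c \<le> 1" for c
      unfolding first_block_interpolation
      using p Py Pz that by (intro proper_closed_convex_interpolation) auto
  next
    fix c :: real
    have "(1 - c) *\<^sub>R y + c *\<^sub>R z - xt = (1 - c) *\<^sub>R (y - xt) + c *\<^sub>R (z - xt)"
      by (simp add: algebra_simps)
    then have "?qT ((1 - c) *\<^sub>R y + c *\<^sub>R z - xt)
        = (1 - c) * ?qT (y - xt) + c * ?qT (z - xt) - c * (1 - c) * ?qT (z - y)"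
      using psd_quadratic_interpolation[OF psd_sGS_op, of c "y - xt" "z - xt"] by simp
    then show "g ((1 - c) *\<^sub>R y + c *\<^sub>R z) = (1 - c) * g y + c * g z - c * (1 - c) * (?qH (z - y) / 2)"
      unfolding g quad_interpolation[OF psd_Q] inner_Q_hat
      by (simp only: inner_add_left inner_scaleR_left) (simp add: field_simps)
  next
    fix w
    show "ereal (f - quad Q b y + g y) \<le> p (first_block e w) + ereal (g w)"
    proof -
      have "p (first_block e y) + ereal (g y) \<le> p (first_block e w) + ereal (g w)"
        using min unfolding is_arg_min_linorder g_def by blast
      then show ?thesis by (simp add: Py)
    qed
  qed
  \<comment> \<open>The proximal term at \<open>y\<close> is discarded and the one at
    \<open>z\<close> is enlarged to the norm of \<open>H\<close>, so that both sides use the same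
    norm.\<close>
  moreover have "0 \<le> ?qT (y - xt)" "?qT (z - xt) \<le> ?qH (z - xt)"
    using psd_sGS_op psd_Q by (auto simp: psd_def inner_Q_hat)
  moreover have "y \<bullet> ?\<Delta> - z \<bullet> ?\<Delta> \<le> M_const blk Q * r * wnorm H (z - y)"
    using inner_Delta_le[OF d, of "z - y"] by (simp add: inner_diff_left)
  ultimately show ?thesis
    unfolding g wnorm_power2[OF psd_H] by (simp add: field_simps)
qed

text \<open>Each iterate minimizes its Step 1 objective, whose value at \<open>x 0\<close> is
  finite; hence \<open>p\<close> is finite at every iterate. The optimal value lies below the finite
  value at \<open>x 0\<close>.\<close>

lemma algorithm1_values:
  assumes p: "proper_closed_convex p"
    and xstar: "is_arg_min (objective e p Q b) (\<lambda>z. True) xstar"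
    and alg: "algorithm1 blk e p Q b x xt dt d t \<epsilon>"
  obtains F Fs where "\<And>k. objective e p Q b (x k) = ereal (F k)" "objective e p Q b xstar = ereal Fs"
    "\<And>k. Fs \<le> F k"
proof -
  have p_ninf: "p u \<noteq> -\<infinity>" for u using p by (simp add: proper_closed_convex_def)
  have p0: "p (first_block e (x 0)) < \<infinity>" using alg by (simp add: algorithm1_def)
  have "p (first_block e (x k)) \<noteq> \<infinity>" for k
  proof (cases k)
    case 0
    then show ?thesis using p0 by auto
  next
    case (Suc n)
    define h where "h z = quad Q b z + 1/2 * (wnorm (sGS_op blk Q) (z - xt k))\<^sup>2
      - z \<bullet> Delta blk Q (dt k) (d k)" for z
    have "p (first_block e (x k)) + ereal (h (x k)) \<le> p (first_block e (x 0)) + ereal (h (x 0))"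
      using alg Suc by (simp add: algorithm1_def is_arg_min_linorder h_def)
    also have "\<dots> < \<infinity>" using p0 by simp
    finally show ?thesis by auto
  qed
  then have "\<exists>r. objective e p Q b (x k) = ereal r" for k
    using p_ninf unfolding objective_def by (cases "p (first_block e (x k))") auto
  then obtain F where F: "\<And>k. objective e p Q b (x k) = ereal (F k)" by metis
  have le: "objective e p Q b xstar \<le> objective e p Q b (x k)" for k
    using xstar by (simp add: is_arg_min_linorder)
  from le[of 0] F[of 0] have "objective e p Q b xstar \<noteq> \<infinity>" by auto
  moreover have "objective e p Q b xstar \<noteq> -\<infinity>"
    using p_ninf unfolding objective_def by simp
  ultimately obtain Fs where Fs: "objective e p Q b xstar = ereal Fs"
    by (cases "objective e p Q b xstar") auto
  from that[OF F Fs] show thesis using le by (simp add: F Fs)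
qed

lemma (in block_matrix) algorithm1_inexact_apg:
  assumes p: "proper_closed_convex p"
    and alg: "algorithm1 blk e p Q b x xt dt d t \<epsilon>"
    and F: "\<And>k. objective e p Q b (x k) = ereal (F k)" "objective e p Q b xstar = ereal Fs"
      "\<And>k. Fs \<le> F k"
    and t: "\<And>k. 1 \<le> t (Suc k)"
  shows "inexact_apg (objective e p Q b) (wnorm H) x xt t (\<lambda>k. M_const blk Q * \<epsilon> k) F xstar Fs"
proof
  note N = wnorm_eq_norm_psd_sqrt[OF psd_H]
  show "objective e p Q b ((1 - c) *\<^sub>R u + c *\<^sub>R v) \<le> ereal ((1 - c) * a' + c * b')"
    if "objective e p Q b u \<le> ereal a'" "objective e p Q b v \<le> ereal b'" "0 \<le> c" "c \<le> 1" for u v a' b' c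
    using objective_convex[OF psd_Q p] that .
  show "wnorm H (c *\<^sub>R u) = \<bar>c\<bar> * wnorm H u" for c u
    by (simp add: N matrix_vector_mult_scaleR)
  show "wnorm H (u + v) \<le> wnorm H u + wnorm H v" for u v
    by (simp add: N matrix_vector_right_distrib norm_triangle_ineq)
  show "0 \<le> wnorm H u" for u by (simp add: N)
  show "0 \<le> M_const blk Q * \<epsilon> (Suc k)" for k
    using alg by (simp add: algorithm1_def M_const_nonneg)
  show "t 1 = 1" using alg by (simp add: algorithm1_def)
  \<comment> \<open>For \<open>k = 0\<close> the difference vanishes, and the formula reduces to the
    initialization \<open>xt 1 = x 0\<close>.\<close>
  show "xt (Suc k) = x k + ((t k - 1) / t (Suc k)) *\<^sub>R (x k - x (k - 1))" for k
    using alg by (cases "k = 0") (auto simp: algorithm1_def)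
  show "F (Suc k) + (wnorm H (z - x (Suc k)))\<^sup>2 / 2 \<le> v + (wnorm H (z - xt (Suc k)))\<^sup>2 / 2
      + M_const blk Q * \<epsilon> (Suc k) / t (Suc k) * wnorm H (z - x (Suc k))"
    if "objective e p Q b z \<le> ereal v" for k z v
  proof -
    have "F (Suc k) + (wnorm H (z - x (Suc k)))\<^sup>2 / 2 \<le> v + (wnorm H (z - xt (Suc k)))\<^sup>2 / 2
      + M_const blk Q * (\<epsilon> (Suc k) / t (Suc k)) * wnorm H (z - x (Suc k))"
    proof (rule inexact_step[OF p _ _ _ F(1) that])
      show "norm (dt (Suc k)) \<le> \<epsilon> (Suc k) / t (Suc k)" "norm (d (Suc k)) \<le> \<epsilon> (Suc k) / t (Suc k)"
        using alg by (auto simp: algorithm1_def)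
      show "is_arg_min (\<lambda>z. p (first_block e z) +
        ereal (quad Q b z + 1/2 * (wnorm (sGS_op blk Q) (z - xt (Suc k)))\<^sup>2
          - z \<bullet> Delta blk Q (dt (Suc k)) (d (Suc k)))) (\<lambda>z. True) (x (Suc k))"
        using alg unfolding algorithm1_def by auto
    qed
    then show ?thesis by simp
  qed
qed (use F t in auto)

theorem proposition2:
  fixes s :: nat
    and blk :: "'n::finite \<Rightarrow> nat"
    and e :: "'m::finite \<Rightarrow> 'n"
    and Q :: "real^'n^'n"
    and b xstar :: "real^'n"
    and p :: "real^'m \<Rightarrow> ereal"
    and x xt dt d :: "nat \<Rightarrow> real^'n"
    and t \<epsilon> :: "nat \<Rightarrow> real"
  assumes "s \<ge> 2"
    and "range blk = {1..s}"
    and "bij_betw e UNIV {k. blk k = 1}"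
    and "psd Q"
    and "\<forall>i\<in>{1..s}. diag_block_pd blk Q i"
    and "proper_closed_convex p"
    and "is_arg_min (objective e p Q b) (\<lambda>z. True) xstar"
    and "algorithm1 blk e p Q b x xt dt d t \<epsilon>"
  shows "((\<forall>k\<ge>1. t (k + 1) = (1 + sqrt (1 + 4 * (t k)\<^sup>2)) / 2) \<longrightarrow>
           (\<forall>k\<ge>1.
              0 \<le> objective e p Q b (x k) - objective e p Q b xstar \<and>
              objective e p Q b (x k) - objective e p Q b xstar
                \<le> ereal (2 / (real k + 1)\<^sup>2 *
                    (wnorm (Q_hat blk Q) (x 0 - xstar)
                     + 2 * M_const blk Q * (\<Sum>i=1..k. \<epsilon> i))\<^sup>2)))
       \<and> ((\<forall>k\<ge>1. t k = 1) \<longrightarrow>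
           (\<forall>k\<ge>1.
              0 \<le> objective e p Q b (x k) - objective e p Q b xstar \<and>
              objective e p Q b (x k) - objective e p Q b xstar
                \<le> ereal (1 / (2 * real k) *
                    (wnorm (Q_hat blk Q) (x 0 - xstar)
                     + 4 * M_const blk Q * (\<Sum>i=1..k. real i * \<epsilon> i))\<^sup>2)))"
proof -
  interpret block_matrix blk Q
    using assms(2,4,5) by unfold_locales auto
  obtain F Fs where F: "\<And>k. objective e p Q b (x k) = ereal (F k)"
    "objective e p Q b xstar = ereal Fs" "\<And>k. Fs \<le> F k"
    using algorithm1_values[OF assms(6,7,8)] by blast
  note apg = algorithm1_inexact_apg[OF assms(6,8) F]
  have t1: "t 1 = 1" and t_le: "\<And>k. k \<ge> 1 \<Longrightarrow> (t (Suc k))\<^sup>2 - t (Suc k) \<le> (t k)\<^sup>2"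
    and \<epsilon>: "\<And>k. k \<ge> 1 \<Longrightarrow> 0 \<le> \<epsilon> k"
    using assms(8) by (auto simp: algorithm1_def)
  let ?N = "wnorm H (x 0 - xstar)" and ?M = "M_const blk Q"
  have N: "0 \<le> ?N" by (simp add: wnorm_eq_norm_psd_sqrt[OF psd_H])
  have accelerated: "F k - Fs \<le> 2 / (real k + 1)\<^sup>2 * (?N + 2 * ?M * (\<Sum>i=1..k. \<epsilon> i))\<^sup>2"
    if t: "\<forall>k\<ge>1. t (k + 1) = (1 + sqrt (1 + 4 * (t k)\<^sup>2)) / 2" and k: "k \<ge> 1" for k
  proof -
    have ge: "(real k + 1) / 2 \<le> t k" if "k \<ge> 1" for k
      using fista_parameter_ge[of t k] t1 t that by blast
    have t_ge_1: "1 \<le> t (Suc k)" for k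
      using ge[of "Suc k"] by simp
    interpret inexact_apg "objective e p Q b" "wnorm H" x xt t "\<lambda>k. ?M * \<epsilon> k" F xstar Fs
      using apg t_ge_1 by blast
    have "((real k + 1) / 2)\<^sup>2 * (F k - Fs) \<le> (t k)\<^sup>2 * (F k - Fs)"
      using ge[OF k] F(3)[of k] by (intro mult_right_mono power_mono) auto
    also have "\<dots> \<le> (?N + 2 * ?M * (\<Sum>i=1..k. \<epsilon> i))\<^sup>2 / 2"
      using accelerated_bound[OF t_le k] by (simp add: sum_distrib_left mult.assoc)
    finally show ?thesis
      by (simp add: power_divide field_simps)
  qed
  have non_accelerated: "F k - Fs \<le> 1 / (2 * real k) * (?N + 4 * ?M * (\<Sum>i=1..k. real i * \<epsilon> i))\<^sup>2"
    if t: "\<forall>k\<ge>1. t k = 1" and k: "k \<ge> 1" for k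
  proof -
    interpret inexact_apg "objective e p Q b" "wnorm H" x xt t "\<lambda>k. ?M * \<epsilon> k" F xstar Fs
      using apg t by auto
    have S: "0 \<le> ?M * (\<Sum>i=1..k. real i * \<epsilon> i)"
      using \<epsilon> by (intro mult_nonneg_nonneg sum_nonneg M_const_nonneg) auto
    have "real k * (F k - Fs) \<le> (?N + 2 * (?M * (\<Sum>i=1..k. real i * \<epsilon> i)))\<^sup>2 / 2"
      using constant_step_bound[of k] t by (simp add: sum_distrib_left mult.left_commute)
    \<comment> \<open>The recursion gives the factor 2 on the error sum; nonnegativity of the sum
      allows weakening it to the 4 of the claim.\<close>
    also have "\<dots> \<le> (?N + 4 * (?M * (\<Sum>i=1..k. real i * \<epsilon> i)))\<^sup>2 / 2"
      using N S by (intro divide_right_mono power_mono) auto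
    finally show ?thesis
      using k by (simp add: field_simps)
  qed
  show ?thesis
    using accelerated non_accelerated F(3) by (simp add: F(1,2))
qed

end
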